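(* Consider any family $\mathcal{F}$ of concept classes with VC dimension $d_{\mathrm{VC}}$. There exists an algorithm that uses at most $O(T^{d_{\mathrm{VC}}+1})$ weak consistency queries and obtains optimal mistake bounds for transductive online learning (known to be upper bounded by $\min\{d_{\mathrm{LD}},\, d_{\mathrm{VC}}\log T\}$), and also obtains optimal regret (known to be upper bounded by $\tilde O\big(\sqrt{T\min\{d_{\mathrm{LD}},\, d_{\mathrm{VC}}\log T\}}\big)$). Here $d_{\mathrm{LD}}$ is the Littlestone dimension of the class and $T$ is the number of rounds.
   Context: Transductive online learning with oracle access. Let $\mathcal{X}$ be the instance space and $\mathcal{F}$ a family of concept classes $\mathcal{C}\subseteq\{0,1\}^{\mathcal{X}}$, known to the learner. An oblivious adversary selects an unknown $\mathcal{C}\in\mathcal{F}$ and a sequence $x_{1:T}\in\mathcal{X}^T$, and the whole sequence is revealed to the learner at the start. The learner can access $\mathcal{C}$ only through an oracle. In each round $t=1,\dots,T$ the learner picks a distribution on $\{0,1\}$ and predicts $\hat y_t$ drawn from it; then the adversary reveals $y_t\in\{0,1\}$. In the realizable setting there is $c\in\mathcal{C}$ with $y_t=c(x_t)$ for all $t$, and performance is measured by the expected number of mistakes $\sum_t\mathbb{I}[\hat y_t\neq y_t]$, in the worst case over $\mathcal{C}\in\mathcal{F}$, $c\in\mathcal{C}$ and $x_{1:T}$. In the agnostic setting the labels are arbitrary, and performance is measured by the expected regret $\sum_t\mathbb{I}[\hat y_t\neq y_t]-\inf_{c\in\mathcal{C}}\sum_t\mathbb{I}[c(x_t)\neq y_t]$,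 in the worst case over $\mathcal{C}\in\mathcal{F}$ and $(x_{1:T},y_{1:T})$. "Optimal" means that the bound matches the one for standard transductive online learning, in which the learner knows the concept class $\mathcal{C}$ in advance. Weak consistency oracle: given any sequence $S=(x_1,y_1),\dots,(x_n,y_n)$ in $\mathcal{X}\times\{0,1\}$, it returns "realizable" if some $c\in\mathcal{C}$ is consistent with $S$, and "not realizable" otherwise. VC dimension of $\mathcal{C}$: the largest $n$ such that there are $n$ points $x_1,\dots,x_n\in\mathcal{X}$ with $\{(c(x_1),\dots,c(x_n)):c\in\mathcal{C}\}=\{0,1\}^n$. Littlestone dimension of $\mathcal{C}$: the largest depth $n$ of a complete binary tree whose internal nodes are labeled by points of $\mathcal{X}$ such that for every root-to-leaf path, with edge labels $y_1,\dots,y_n\in\{0,1\}$ and visited nodes $x_1,\dots,x_n$, some $c\in\mathcal{C}$ has $c(x_i)=y_i$ for all $i$. The notation $\tilde O$ hides logarithmic factors.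
   Formalization: The two upper bounds are stated for T ≥ 2 with log base 2, since at T = 1 the bound d_VC log T is 0 and fails for two constant concepts; the algorithm is told whether the setting is realizable or agnostic, as no single learner is exactly optimal in both. *)

theory Defs
  imports "HOL-Probability.Probability" "HOL-Library.Tree"
begin

text \<open>
  The instance space is the type \<open>'x\<close>, labels are booleans, a concept class is a
  set of functions \<open>'x \<Rightarrow> bool\<close>, and a sequence \<open>x\<^sub>1,\<dots>,x\<^sub>T\<close> is a list.
\<close>

section \<open>VC and Littlestone dimension\<close>

definition vc_shatters :: "('x \<Rightarrow> bool) set \<Rightarrow> 'x list \<Rightarrow> bool" where
  "vc_shatters C xs \<longleftrightarrow> (\<lambda>c. map c xs) ` C = {ys. length ys = length xs}"

definition vc_dim :: "('x \<Rightarrow> bool) set \<Rightarrow> enat" where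
  "vc_dim C = (SUP xs \<in> {xs. vc_shatters C xs}. enat (length xs))"

text \<open>The nodes visited when following edge labels: \<open>False\<close> goes left, \<open>True\<close> goes right.\<close>

fun visited :: "'x tree \<Rightarrow> bool list \<Rightarrow> 'x list" where
  "visited (Node l x r) (y # ys) = x # visited (if y then r else l) ys"
| "visited _ _ = []"

definition littlestone_shatters :: "('x \<Rightarrow> bool) set \<Rightarrow> 'x tree \<Rightarrow> bool" where
  "littlestone_shatters C t \<longleftrightarrow> complete t \<and>
     (\<forall>ys. length ys = height t \<longrightarrow> (\<exists>c\<in>C. map c (visited t ys) = ys))"

definition littlestone_dim :: "('x \<Rightarrow> bool) set \<Rightarrow> enat" where
  "littlestone_dim C = (SUP t \<in> {t. littlestone_shatters C t}. enat (height t))"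

section \<open>Queries and learners\<close>

type_synonym 'x seq_oracle = "('x \<times> bool) list \<Rightarrow> bool"

definition weak_consistency :: "('x \<Rightarrow> bool) set \<Rightarrow> 'x seq_oracle" where
  "weak_consistency C S \<longleftrightarrow> (\<exists>c\<in>C. \<forall>(x, y)\<in>set S. c x = y)"

text \<open>
  A learner is its interaction tree. \<open>Query S k\<close> asks whether \<open>S\<close> is realizable and continues
  with \<open>k a\<close> on answer \<open>a\<close>. \<open>Predict p k\<close> draws the prediction of the current round from
  \<open>p\<close> and continues with \<open>k yh y\<close>, where \<open>yh\<close> is the drawn prediction and \<open>y\<close> the
  revealed label. Hence the next action may depend on everything observed so far, and
  queries may be made in any round.
\<close>

datatype 'x learner =
    Halt
  | Query "('x \<times> bool) list" "bool \<Rightarrow> 'x learner"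
  | Predict "bool pmf" "bool \<Rightarrow> bool \<Rightarrow> 'x learner"

text \<open>
  Expected number of mistakes against a fixed label sequence. A learner that halts early
  is charged one mistake for each round in which it makes no prediction.
\<close>

primrec exp_mistakes :: "'x seq_oracle \<Rightarrow> 'x learner \<Rightarrow> bool list \<Rightarrow> real" where
  "exp_mistakes orc Halt ys = real (length ys)"
| "exp_mistakes orc (Query S k) ys = exp_mistakes orc (k (orc S)) ys"
| "exp_mistakes orc (Predict p k) ys = (case ys of [] \<Rightarrow> 0 | y # ys' \<Rightarrow>
     measure_pmf.expectation p (\<lambda>yh. of_bool (yh \<noteq> y) + exp_mistakes orc (k yh y) ys'))"

text \<open>Number of queries in the worst case over the drawn predictions.\<close>

primrec num_queries :: "'x seq_oracle \<Rightarrow> 'x learner \<Rightarrow> bool list \<Rightarrow> nat" where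
  "num_queries orc Halt ys = 0"
| "num_queries orc (Query S k) ys = Suc (num_queries orc (k (orc S)) ys)"
| "num_queries orc (Predict p k) ys = (case ys of [] \<Rightarrow> 0 | y # ys' \<Rightarrow>
     max (num_queries orc (k False y) ys') (num_queries orc (k True y) ys'))"

primrec query_free :: "'x learner \<Rightarrow> bool" where
  "query_free Halt \<longleftrightarrow> True"
| "query_free (Query S k) \<longleftrightarrow> False"
| "query_free (Predict p k) \<longleftrightarrow> (\<forall>yh y. query_free (k yh y))"

section \<open>Transductive online learning\<close>

text \<open>
  In the transductive protocol a learner receives the whole sequence \<open>xs\<close> first, so it is
  a function \<open>L :: 'x list \<Rightarrow> 'x learner\<close>, with \<open>T = length xs\<close>. All suprema and infima
  below are over bounded sets of reals, nonempty if \<open>C\<close> is: the expected number of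
  mistakes lies between \<open>0\<close> and \<open>T\<close>, the regret between \<open>-T\<close> and \<open>T\<close>.
\<close>

definition worst_mistakes ::
  "('x \<Rightarrow> bool) set \<Rightarrow> nat \<Rightarrow> ('x list \<Rightarrow> 'x learner) \<Rightarrow> real" where
  "worst_mistakes C T L =
     (SUP (xs, c) \<in> {xs. length xs = T} \<times> C.
        exp_mistakes (weak_consistency C) (L xs) (map c xs))"

definition exp_regret ::
  "('x \<Rightarrow> bool) set \<Rightarrow> ('x list \<Rightarrow> 'x learner) \<Rightarrow> 'x list \<Rightarrow> bool list \<Rightarrow> real" where
  "exp_regret C L xs ys =
     exp_mistakes (weak_consistency C) (L xs) ys
     - (INF c\<in>C. \<Sum>t<length xs. of_bool (c (xs ! t) \<noteq> ys ! t))"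

definition worst_regret ::
  "('x \<Rightarrow> bool) set \<Rightarrow> nat \<Rightarrow> ('x list \<Rightarrow> 'x learner) \<Rightarrow> real" where
  "worst_regret C T L =
     (SUP (xs, ys) \<in> {xs. length xs = T} \<times> {ys. length ys = T}. exp_regret C L xs ys)"

text \<open>
  The optimal values of standard transductive online learning. The infimum is taken for
  each fixed \<open>C\<close>, so these learners may depend on \<open>C\<close>; they make no queries.
\<close>

definition opt_mistakes :: "('x \<Rightarrow> bool) set \<Rightarrow> nat \<Rightarrow> real" where
  "opt_mistakes C T = (INF L \<in> {L. \<forall>xs. query_free (L xs)}. worst_mistakes C T L)"

definition opt_regret :: "('x \<Rightarrow> bool) set \<Rightarrow> nat \<Rightarrow> real" where
  "opt_regret C T = (INF L \<in> {L. \<forall>xs. query_free (L xs)}. worst_regret C T L)"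

text \<open>
  \<open>min {d\<^sub>L\<^sub>D, d log T}\<close>. The Littlestone dimension may be infinite; the minimum is
  always finite, so \<open>real_of_ereal\<close> loses nothing.
\<close>

definition min_dim_bound :: "('x \<Rightarrow> bool) set \<Rightarrow> nat \<Rightarrow> nat \<Rightarrow> real" where
  "min_dim_bound C d T =
     real_of_ereal (min (ereal_of_enat (littlestone_dim C)) (ereal (real d * log 2 (real T))))"

text \<open>
  The realizable and the agnostic setting are two different games, and the learner is told
  which one it plays. No single learner attains both optimal values exactly in general:
  for the two constant concepts and \<open>T = 3\<close>, a learner with the optimal mistake bound
  \<open>1/2\<close> has regret at least \<open>1\<close>, while the optimal regret is \<open>3/4\<close>.
\<close>

datatype setting = Realizable | Agnostic

end

(*
  Weak consistency queries on ever longer labelled suffixes of x_1, ..., x_T compute the set P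
  of label patterns of the class on the sequence: a pattern on a suffix can be extended by one
  point in two ways, and Sauer-Shelah leaves at most T^d patterns per suffix. After that the
  learner plays a finite game with known P and needs no further queries. Both settings are
  the game in which the adversary wants to maximise expected mistakes plus a payoff of the final
  label sequence: minus the smallest Hamming distance to P in the agnostic setting, and a
  large penalty for leaving P in the realizable one. A state whose successors have values a and b
  has value max a, b, (1 + a + b) / 2. The prediction that achieves it and the random label
  sequence that forces it show that the game has this value, whatever the learner knows.
  In the realizable game, halving gives log |P| / 2 and merging shattered trees gives the
  Littlestone dimension. In the agnostic game, the exponential weights potential gives
  ln |P| / \<eta> + T \<eta> / 8; with \<eta> = sqrt (d / T) this suffices, as d is at most the
  Littlestone dimension.
*)
theory Submission
  imports Defs
begin

section \<open>Prediction games with a terminal payoff\<close>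

text \<open>If \<open>True\<close> is predicted with probability \<open>p\<close>, the labels
  \<open>True\<close> and \<open>False\<close> lead to \<open>1 - p + a\<close> and
  \<open>p + b\<close>. The formula is the least maximum of the two over \<open>p\<close> in [0, 1];
  its third term is the balanced case.\<close>

fun game_value :: "nat \<Rightarrow> (bool list \<Rightarrow> real) \<Rightarrow> real" where
  "game_value 0 \<phi> = \<phi> []"
| "game_value (Suc n) \<phi> =
     (let a = game_value n (\<lambda>ys. \<phi> (True # ys)); b = game_value n (\<lambda>ys. \<phi> (False # ys))
      in max (max a b) ((1 + a + b) / 2))"

text \<open>The probability equalises \<open>1 - p + a\<close> and \<open>p + b\<close>, cut off to
  [0, 1]. \<open>Halt\<close> costs nothing once all \<open>n\<close> labels are revealed.\<close>

fun play :: "nat \<Rightarrow> (bool list \<Rightarrow> real) \<Rightarrow> 'x learner" where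
  "play 0 \<phi> = Halt"
| "play (Suc n) \<phi> =
     (let a = game_value n (\<lambda>ys. \<phi> (True # ys)); b = game_value n (\<lambda>ys. \<phi> (False # ys))
      in Predict (bernoulli_pmf (min 1 (max 0 ((1 + a - b) / 2))))
           (\<lambda>_ y. play n (\<lambda>ys. \<phi> (y # ys))))"

text \<open>
  Expectation of \<open>f\<close> under the minimax-optimal random label sequence: the next label is
  deterministic if one branch is worth at least one mistake more than the other, and a
  fair coin otherwise.
\<close>

fun adversary :: "nat \<Rightarrow> (bool list \<Rightarrow> real) \<Rightarrow> (bool list \<Rightarrow> real) \<Rightarrow> real" where
  "adversary 0 \<phi> f = f []"
| "adversary (Suc n) \<phi> f =
     (let a = game_value n (\<lambda>ys. \<phi> (True # ys)); b = game_value n (\<lambda>ys. \<phi> (False # ys));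
          fa = adversary n (\<lambda>ys. \<phi> (True # ys)) (\<lambda>ys. f (True # ys));
          fb = adversary n (\<lambda>ys. \<phi> (False # ys)) (\<lambda>ys. f (False # ys))
      in if b + 1 \<le> a then fa else if a + 1 \<le> b then fb else (fa + fb) / 2)"

lemma expectation_bool_pmf:
  fixes f :: "bool \<Rightarrow> real"
  shows "measure_pmf.expectation p f = pmf p True * f True + (1 - pmf p True) * f False"
proof -
  have "pmf p True + pmf p False = (\<Sum>b\<in>UNIV. pmf p b)"
    by (simp add: UNIV_bool)
  also have "\<dots> = 1" by (rule sum_pmf_eq_1) auto
  finally have "pmf p False = 1 - pmf p True" by simp
  moreover have "measure_pmf.expectation p f = (\<Sum>b\<in>UNIV. pmf p b * f b)"
    by (subst integral_measure_pmf[of UNIV]) auto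
  ultimately show ?thesis by (simp add: UNIV_bool)
qed

lemma exp_mistakes_Predict_Cons:
  "exp_mistakes orc (Predict p k) (y # ys) =
     pmf p True * (of_bool (True \<noteq> y) + exp_mistakes orc (k True y) ys) +
     (1 - pmf p True) * (of_bool (False \<noteq> y) + exp_mistakes orc (k False y) ys)"
  by (simp add: expectation_bool_pmf)

lemma exp_mistakes_bounds:
  "0 \<le> exp_mistakes orc L ys \<and> exp_mistakes orc L ys \<le> real (length ys)"
proof (induction L arbitrary: ys)
  case (Predict p k)
  show ?case
  proof (cases ys)
    case (Cons y ys')
    define q where "q = pmf p True"
    define g where "g = (\<lambda>b. of_bool (b \<noteq> y) + exp_mistakes orc (k b y) ys')"
    have q: "0 \<le> q" "q \<le> 1" by (auto simp: q_def pmf_le_1)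
    have g: "0 \<le> g b" "g b \<le> real (length ys)" for b
      using Predict.IH[of "k b" "k b y" ys'] Cons by (auto simp: g_def of_bool_def)
    have "exp_mistakes orc (Predict p k) ys = q * g True + (1 - q) * g False"
      unfolding Cons q_def g_def by (rule exp_mistakes_Predict_Cons)
    moreover have "\<dots> \<le> real (length ys)"
      using g q by (intro convex_bound_le) auto
    moreover have "0 \<le> q * g True + (1 - q) * g False"
      using g q by simp
    ultimately show ?thesis by linarith
  qed simp
qed auto

lemma num_queries_play [simp]: "num_queries orc (play n \<phi>) ys = 0"
  by (induction n arbitrary: \<phi> ys) (auto simp: Let_def split: list.split)

section \<open>Matching upper and lower bounds for the game value\<close>

text \<open>Backward induction: for either next label, the expected mistake of the round plus the
  value of the remaining game is at most the current value.\<close>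

lemma play_upper:
  assumes "length ys = n"
  shows "exp_mistakes orc (play n \<phi>) ys + \<phi> ys \<le> game_value n \<phi>"
  using assms
proof (induction n arbitrary: \<phi> ys)
  case (Suc n)
  then obtain y ys' where ys: "ys = y # ys'" "length ys' = n" by (cases ys) auto
  define a where "a = game_value n (\<lambda>ys. \<phi> (True # ys))"
  define b where "b = game_value n (\<lambda>ys. \<phi> (False # ys))"
  define p where "p = min 1 (max 0 ((1 + a - b) / 2))"
  have p: "0 \<le> p" "p \<le> 1" by (auto simp: p_def)
  have "exp_mistakes orc (play (Suc n) \<phi>) ys =
     (if y then 1 - p else p) + exp_mistakes orc (play n (\<lambda>ys. \<phi> (y # ys))) ys'"
    using p unfolding ys play.simps Let_def exp_mistakes_Predict_Cons
    by (simp flip: a_def b_def p_def add: algebra_simps)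
  moreover have "exp_mistakes orc (play n (\<lambda>ys. \<phi> (y # ys))) ys' + \<phi> ys
      \<le> (if y then a else b)"
    using Suc.IH[OF ys(2), of "\<lambda>ys. \<phi> (y # ys)"] ys(1) by (auto simp: a_def b_def)
  moreover have "(if y then 1 - p + a else p + b) \<le> game_value (Suc n) \<phi>"
    by (simp flip: a_def b_def add: Let_def) (auto simp: p_def min_def max_def field_simps)
  ultimately show ?case by (auto split: if_splits)
qed simp

text \<open>\<open>adversary\<close> is an average over label sequences, and some sequence does at
  least as well as the average.\<close>

lemma adversary_le_some: "\<exists>ys. length ys = n \<and> adversary n \<phi> f \<le> f ys"
proof (induction n arbitrary: \<phi> f)
  case (Suc n)
  define fy where "fy = (\<lambda>y. adversary n (\<lambda>ys. \<phi> (y # ys)) (\<lambda>ys. f (y # ys)))"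
  have "adversary (Suc n) \<phi> f \<le> max (fy True) (fy False)"
    by (auto simp: Let_def fy_def max_def)
  then obtain y where y: "adversary (Suc n) \<phi> f \<le> fy y"
    by (meson le_max_iff_disj)
  moreover obtain ys where "length ys = n" "fy y \<le> f (y # ys)"
    using Suc.IH[of "\<lambda>ys. \<phi> (y # ys)" "\<lambda>ys. f (y # ys)"] by (auto simp: fy_def)
  ultimately show ?case by (intro exI[of _ "y # ys"]) auto
qed simp

lemma adversary_combine:
  "adversary n \<phi> (\<lambda>ys. c + u * f ys + v * g ys) =
     c + u * adversary n \<phi> f + v * adversary n \<phi> g"
  by (induction n arbitrary: \<phi> f g) (auto simp: Let_def field_simps)

text \<open>\<open>e y\<close> stands for the expected mistakes of this round on label
  \<open>y\<close>. A forced label needs only \<open>e y\<close> to be nonnegative; a fair coin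
  earns half of \<open>e True + e False\<close>, which covers the 1/2 in the value.\<close>

lemma adversary_step:
  assumes "\<And>y. game_value n (\<lambda>ys. \<phi> (y # ys)) + e y
     \<le> adversary n (\<lambda>ys. \<phi> (y # ys)) (\<lambda>ys. f (y # ys))"
    and "0 \<le> e True" "0 \<le> e False" "1 \<le> e True + e False"
  shows "game_value (Suc n) \<phi> \<le> adversary (Suc n) \<phi> f"
  using assms(1)[of True] assms(1)[of False] assms(2-)
  by (simp add: Let_def field_simps max_def)

text \<open>Induction over the interaction tree with the game varying. A halted learner still pays
  for each remaining round, hence the inner induction on \<open>n\<close>.\<close>

lemma adversary_lower:
  "game_value n \<phi> \<le> adversary n \<phi> (\<lambda>ys. exp_mistakes orc L ys + \<phi> ys)"
proof (induction L arbitrary: n \<phi>)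
  case Halt
  show ?case
  proof (induction n arbitrary: \<phi>)
    case (Suc n)
    have *: "adversary n \<psi> (\<lambda>ys. 1 + real (length ys) + \<psi> ys) =
        1 + adversary n \<psi> (\<lambda>ys. real (length ys) + \<psi> ys)" for \<psi>
      using adversary_combine[of n \<psi> 1 1 "\<lambda>ys. real (length ys) + \<psi> ys" 0 "\<lambda>_. 0"]
      by (simp add: add.assoc)
    show ?case
      by (rule adversary_step[where e = "\<lambda>_. 1"]) (use Suc.IH * in auto)
  qed simp
next
  case (Query S k)
  then show ?case by simp
next
  case (Predict p k)
  show ?case
  proof (cases n)
    case 0
    then show ?thesis by simp
  next
    case (Suc m)
    define q where "q = pmf p True"
    have q: "0 \<le> q" "q \<le> 1" by (auto simp: q_def pmf_le_1)
    define e where "e = (\<lambda>y. q * of_bool (True \<noteq> y) + (1 - q) * of_bool (False \<noteq> y))"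
    have "game_value m (\<lambda>ys. \<phi> (y # ys)) + e y \<le> adversary m (\<lambda>ys. \<phi> (y # ys))
        (\<lambda>ys. exp_mistakes orc (Predict p k) (y # ys) + \<phi> (y # ys))" for y
    proof -
      let ?\<phi> = "\<lambda>ys. \<phi> (y # ys)"
      let ?A = "\<lambda>b. adversary m ?\<phi> (\<lambda>ys. exp_mistakes orc (k b y) ys + ?\<phi> ys)"
      \<comment> \<open>As \<open>q\<close> and \<open>1 - q\<close> sum to 1, the payoff can be
        shared out between the two subtrees, so that the induction hypothesis applies to
        each.\<close>
      have "(\<lambda>ys. exp_mistakes orc (Predict p k) (y # ys) + ?\<phi> ys) = (\<lambda>ys. e y +
          q * (exp_mistakes orc (k True y) ys + ?\<phi> ys) +
          (1 - q) * (exp_mistakes orc (k False y) ys + ?\<phi> ys))"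
        unfolding exp_mistakes_Predict_Cons e_def by (auto simp flip: q_def simp: algebra_simps)
      then have "adversary m ?\<phi> (\<lambda>ys. exp_mistakes orc (Predict p k) (y # ys) + ?\<phi> ys) =
          e y + (q * ?A True + (1 - q) * ?A False)"
        by (simp only: adversary_combine)
      \<comment> \<open>Negated because \<open>convex_bound_le\<close> bounds convex combinations
        from above.\<close>
      moreover have "- ?A b \<le> - game_value m ?\<phi>" for b
        using Predict.IH[of "k b" "k b y" m ?\<phi>] by auto
      then have "q * (- ?A True) + (1 - q) * (- ?A False) \<le> - game_value m ?\<phi>"
        using q by (intro convex_bound_le) auto
      ultimately show ?thesis by simp
    qed
    moreover have "0 \<le> e True" "0 \<le> e False" "1 \<le> e True + e False"
      using q by (auto simp: e_def)
    ultimately show ?thesis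
      unfolding Suc by (rule adversary_step)
  qed
qed

text \<open>\<open>L\<close> and \<open>orc\<close> are arbitrary, so the bound also binds learners
  that know the class.\<close>

corollary game_value_lower:
  "\<exists>ys. length ys = n \<and> game_value n \<phi> \<le> exp_mistakes orc L ys + \<phi> ys"
  using adversary_lower[of n \<phi> orc L]
    adversary_le_some[of n \<phi> "\<lambda>ys. exp_mistakes orc L ys + \<phi> ys"] by force

lemma game_value_ge:
  assumes "length ys = n"
  shows "\<phi> ys \<le> game_value n \<phi>"
  using play_upper[OF assms, of "\<lambda>_ :: (unit \<times> bool) list. False" \<phi>]
    exp_mistakes_bounds[of "\<lambda>_ :: (unit \<times> bool) list. False" "play n \<phi>" ys]
  by linarith

text \<open>The learner that halts at once errs \<open>n\<close> times, and no learner can push the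
  total below the value on all sequences.\<close>

lemma game_value_le:
  assumes "\<And>ys. length ys = n \<Longrightarrow> \<phi> ys \<le> B"
  shows "game_value n \<phi> \<le> B + real n"
proof -
  obtain ys :: "bool list" where "length ys = n"
    "game_value n \<phi> \<le> exp_mistakes (\<lambda>_. False) Halt ys + \<phi> ys"
    using game_value_lower by blast
  then show ?thesis using assms[of ys] by simp
qed

section \<open>Learning the projection of the class\<close>

text \<open>Written with a continuation, since an interaction tree has no result to return;
  \<open>k\<close> receives the queries answered positively.\<close>

primrec query_all ::
  "('x \<times> bool) list list \<Rightarrow> (('x \<times> bool) list list \<Rightarrow> 'x learner) \<Rightarrow> 'x learner" where
  "query_all [] k = k []"
| "query_all (S # Ss) k = Query S (\<lambda>a. query_all Ss (\<lambda>R. k (if a then S # R else R)))"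

definition extensions :: "'x \<Rightarrow> ('x \<times> bool) list list \<Rightarrow> ('x \<times> bool) list list" where
  "extensions x R = map (Cons (x, True)) R @ map (Cons (x, False)) R"

primrec with_projection ::
  "'x list \<Rightarrow> (('x \<times> bool) list list \<Rightarrow> 'x learner) \<Rightarrow> 'x learner" where
  "with_projection [] k = k [[]]"
| "with_projection (x # xs) k = with_projection xs (\<lambda>R. query_all (extensions x R) k)"

text \<open>The list that \<open>with_projection\<close> passes to its continuation when
  \<open>orc\<close> answers.\<close>

primrec projection :: "'x seq_oracle \<Rightarrow> 'x list \<Rightarrow> ('x \<times> bool) list list" where
  "projection orc [] = [[]]"
| "projection orc (x # xs) = filter orc (extensions x (projection orc xs))"

abbreviation patterns :: "('x \<Rightarrow> bool) set \<Rightarrow> 'x list \<Rightarrow> bool list set" where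
  "patterns C xs \<equiv> (\<lambda>c. map c xs) ` C"

lemma exp_mistakes_query_all:
  "exp_mistakes orc (query_all Ss k) ys = exp_mistakes orc (k (filter orc Ss)) ys"
  by (induction Ss arbitrary: k) auto

lemma num_queries_query_all:
  "num_queries orc (query_all Ss k) ys = length Ss + num_queries orc (k (filter orc Ss)) ys"
  by (induction Ss arbitrary: k) auto

lemma exp_mistakes_with_projection:
  "exp_mistakes orc (with_projection xs k) ys = exp_mistakes orc (k (projection orc xs)) ys"
  by (induction xs arbitrary: k) (auto simp: exp_mistakes_query_all)

text \<open>Prepending point \<open>i\<close> tests both labels in front of each pattern on the
  points after it, whence the factor 2 and \<open>drop (Suc i)\<close>.\<close>

lemma num_queries_with_projection:
  "num_queries orc (with_projection xs k) ys =
     (\<Sum>i<length xs. 2 * length (projection orc (drop (Suc i) xs)))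
     + num_queries orc (k (projection orc xs)) ys"
  by (induction xs arbitrary: k)
    (auto simp: num_queries_query_all extensions_def sum.lessThan_Suc_shift
      simp del: sum.lessThan_Suc)

text \<open>A concept realizing an extended pattern also realizes its tail, so filtering loses and
  adds nothing. The empty suffix is never queried, and \<open>[[]]\<close> is its correct pattern
  list because \<open>C\<close> is nonempty.\<close>

lemma set_projection:
  assumes "C \<noteq> {}"
  shows "set (projection (weak_consistency C) xs) = (\<lambda>c. map (\<lambda>x. (x, c x)) xs) ` C"
proof (induction xs)
  case Nil
  then show ?case using assms by auto
next
  case (Cons x xs)
  let ?g = "\<lambda>c xs. map (\<lambda>x. (x, c x)) xs"
  have agree: "?g c xs = ?g c' xs" if "\<forall>(x, y)\<in>set (?g c xs). c' x = y" for c c' :: "'a \<Rightarrow> bool"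
    using that by auto
  show ?case
  proof (intro equalityI subsetI)
    fix S assume "S \<in> set (projection (weak_consistency C) (x # xs))"
    then obtain b c where S: "S = (x, b) # ?g c xs" "weak_consistency C S"
      using Cons.IH by (auto simp: extensions_def)
    then obtain c' where c': "c' \<in> C" "\<forall>(x, y)\<in>set S. c' x = y"
      by (auto simp: weak_consistency_def)
    then have "S = ?g c' (x # xs)" using agree[of c c'] S by auto
    then show "S \<in> (\<lambda>c. ?g c (x # xs)) ` C" using c' by blast
  next
    fix S assume "S \<in> (\<lambda>c. ?g c (x # xs)) ` C"
    then obtain c where c: "c \<in> C" "S = (x, c x) # ?g c xs" by auto
    then have "weak_consistency C S" by (auto simp: weak_consistency_def)
    moreover have "?g c xs \<in> set (projection (weak_consistency C) xs)" using Cons.IH c by auto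
    ultimately show "S \<in> set (projection (weak_consistency C) (x # xs))"
      using c(2) by (cases "c x") (auto simp: extensions_def)
  qed
qed

lemma distinct_projection: "distinct (projection orc xs)"
  by (induction xs) (auto simp: extensions_def distinct_map)

lemma patterns_projection:
  assumes "C \<noteq> {}"
  shows "map snd ` set (projection (weak_consistency C) xs) = patterns C xs"
  by (auto simp: set_projection[OF assms] image_image comp_def)

lemma length_projection:
  assumes "C \<noteq> {}"
  shows "length (projection (weak_consistency C) xs) = card (patterns C xs)"
proof -
  let ?R = "set (projection (weak_consistency C) xs)"
  have "inj_on (map snd) ?R"
    unfolding set_projection[OF assms] by (auto simp: inj_on_def)
  then have "card (patterns C xs) = card ?R"
    using card_image patterns_projection[OF assms, of xs] by metis
  then show ?thesis using distinct_card[OF distinct_projection] by metis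
qed

lemma finite_patterns: "finite (patterns C xs)"
proof (rule finite_subset)
  show "patterns C xs \<subseteq> {ys. set ys \<subseteq> UNIV \<and> length ys = length xs}" by auto
qed (rule finite_lists_length_eq, simp)

section \<open>Dimensions\<close>

lemma patterns_Cons:
  "patterns C (x # xs) = Cons True ` patterns {c\<in>C. c x} xs \<union> Cons False ` patterns {c\<in>C. \<not> c x} xs"
  by (auto simp: image_iff)

lemma card_patterns_Cons:
  "card (patterns C (x # xs)) = card (patterns {c\<in>C. c x} xs) + card (patterns {c\<in>C. \<not> c x} xs)"
  unfolding patterns_Cons
  by (subst card_Un_disjoint) (auto simp: finite_patterns card_image)

lemma vc_shatters_iff:
  "vc_shatters C xs \<longleftrightarrow> (\<forall>ys. length ys = length xs \<longrightarrow> (\<exists>c\<in>C. map c xs = ys))"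
  unfolding vc_shatters_def set_eq_iff image_iff mem_Collect_eq by (metis length_map)

text \<open>
  Patterns on \<open>x # xs\<close> exceed those on
  \<open>xs\<close> by the patterns of \<open>C'\<close> below, and \<open>C\<close> shatters \<open>x # ys\<close> if \<open>C'\<close> shatters \<open>ys\<close>.
\<close>

lemma sauer_shelah:
  assumes "\<And>ys. set ys \<subseteq> set xs \<Longrightarrow> length ys = Suc d \<Longrightarrow> \<not> vc_shatters C ys"
  shows "card (patterns C xs) \<le> Suc (length xs) ^ d"
  using assms
proof (induction xs arbitrary: C d)
  case Nil
  have "patterns C [] \<subseteq> {[]}" by auto
  then show ?case using card_mono[of "{[] :: bool list}"] by fastforce
next
  case (Cons x xs)
  let ?n = "Suc (length xs)"
  let ?T = "patterns {c\<in>C. c x} xs" and ?F = "patterns {c\<in>C. \<not> c x} xs"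
  define C' where "C' = {c\<in>C. \<exists>c'\<in>C. c' x \<noteq> c x \<and> map c' xs = map c xs}"
  have "?T \<inter> ?F \<subseteq> patterns C' xs" unfolding C'_def by (auto simp: image_iff) metis+
  then have TF: "card (?T \<inter> ?F) \<le> card (patterns C' xs)"
    by (intro card_mono finite_patterns)
  have un: "?T \<union> ?F = patterns C xs" by auto
  have "card (patterns C (x # xs)) = card (patterns C xs) + card (?T \<inter> ?F)"
    unfolding card_patterns_Cons using card_Un_Int[of ?T ?F] un
    by (simp only: finite_patterns)
  then have le: "card (patterns C (x # xs)) \<le> card (patterns C xs) + card (patterns C' xs)"
    using TF by linarith
  have IH: "card (patterns C xs) \<le> ?n ^ d"
    using Cons.prems by (intro Cons.IH) auto
  have lift: "vc_shatters C (x # ys)" if ys: "vc_shatters C' ys" "set ys \<subseteq> set xs" for ys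
    unfolding vc_shatters_iff
  proof (intro allI impI)
    fix zs :: "bool list" assume "length zs = length (x # ys)"
    then obtain b zs' where zs: "zs = b # zs'" "length zs' = length ys" by (cases zs) auto
    then obtain c where c: "c \<in> C'" "map c ys = zs'" using ys by (auto simp: vc_shatters_iff)
    then obtain c' where c': "c \<in> C" "c' \<in> C" "c' x \<noteq> c x" "map c' xs = map c xs"
      by (auto simp: C'_def)
    then have "\<forall>z\<in>set xs. c' z = c z" by simp
    then have "map c' ys = map c ys" using ys(2) by (intro map_cong) auto
    then show "\<exists>c\<in>C. map c (x # ys) = zs" using c c' zs by (cases "c x = b") auto
  qed
  show ?case
  proof (cases d)
    case 0
    \<comment> \<open>Any element of \<open>C'\<close> would make it shatter the empty list, hence
      \<open>C\<close> shatter \<open>[x]\<close>, whose length is \<open>Suc 0\<close>.\<close>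
    have "C' = {}"
      using lift[of "[]"] Cons.prems[of "[x]"] 0 by (auto simp: vc_shatters_iff)
    then show ?thesis using le IH 0 by simp
  next
    case (Suc e)
    have "card (patterns C' xs) \<le> ?n ^ e"
    proof (intro Cons.IH notI)
      fix ys assume "set ys \<subseteq> set xs" "length ys = Suc e" "vc_shatters C' ys"
      then show False using lift[of ys] Cons.prems[of "x # ys"] Suc by auto
    qed
    \<comment> \<open>\<open>?n ^ Suc e + ?n ^ e\<close> factors as
      \<open>?n ^ e * Suc ?n\<close>.\<close>
    then have "card (patterns C (x # xs)) \<le> ?n ^ e * Suc ?n"
      using le IH Suc by (simp add: algebra_simps)
    also have "\<dots> \<le> Suc ?n ^ e * Suc ?n"
      by (intro mult_right_mono power_mono) auto
    finally show ?thesis using Suc by (simp add: mult.commute)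
  qed
qed

lemma card_patterns_le_vc_dim:
  assumes "vc_dim C = enat d"
  shows "card (patterns C xs) \<le> Suc (length xs) ^ d"
proof (rule sauer_shelah, rule notI)
  fix ys assume "vc_shatters C ys" "length ys = Suc d"
  then have "enat (Suc d) \<le> vc_dim C"
    unfolding vc_dim_def by (intro SUP_upper2[of ys]) auto
  then show False using assms by simp
qed

section \<open>Shattered trees\<close>

primrec level_tree :: "'x list \<Rightarrow> 'x tree" where
  "level_tree [] = Leaf"
| "level_tree (x # xs) = Node (level_tree xs) x (level_tree xs)"

lemma height_level_tree: "height (level_tree xs) = length xs"
  by (induction xs) auto

lemma complete_level_tree: "complete (level_tree xs)"
  by (induction xs) auto

lemma visited_level_tree: "length ys = length xs \<Longrightarrow> visited (level_tree xs) ys = xs"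
  by (induction xs ys rule: list_induct2') auto

text \<open>Every path of \<open>level_tree xs\<close> visits exactly \<open>xs\<close>, so a
  shattered list gives a shattered tree of the same height.\<close>

lemma vc_dim_le_littlestone_dim: "vc_dim C \<le> littlestone_dim C"
  unfolding vc_dim_def littlestone_dim_def
proof (rule SUP_mono)
  fix xs assume "xs \<in> {xs. vc_shatters C xs}"
  then have "littlestone_shatters C (level_tree xs)"
    by (auto simp: littlestone_shatters_def height_level_tree complete_level_tree
        visited_level_tree vc_shatters_iff)
  then show "\<exists>t\<in>{t. littlestone_shatters C t}. enat (length xs) \<le> enat (height t)"
    by (intro bexI[of _ "level_tree xs"]) (auto simp: height_level_tree)
qed

lemma littlestone_shatters_mono:
  "littlestone_shatters C t \<Longrightarrow> C \<subseteq> D \<Longrightarrow> littlestone_shatters D t"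
  unfolding littlestone_shatters_def by blast

text \<open>The first edge label decides in which half of \<open>C\<close> the witness for the rest
  of the path is found. Equal heights keep the tree complete.\<close>

lemma littlestone_shatters_Node:
  assumes "littlestone_shatters {c\<in>C. \<not> c x} l" "littlestone_shatters {c\<in>C. c x} r"
    and "height l = height r"
  shows "littlestone_shatters C (Node l x r)"
  unfolding littlestone_shatters_def
proof (intro conjI allI impI)
  show "complete (Node l x r)" using assms by (auto simp: littlestone_shatters_def)
  fix ys :: "bool list" assume "length ys = height (Node l x r)"
  then obtain y ys' where ys: "ys = y # ys'" "length ys' = height r"
    using assms(3) by (cases ys) auto
  then show "\<exists>c\<in>C. map c (visited (Node l x r) ys) = ys"
    using assms by (cases y) (auto simp: littlestone_shatters_def)
qed

text \<open>For infinite Littlestone dimension the first condition is vacuous and the minimum is its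
  second term.\<close>

lemma min_dim_bound_ge:
  assumes "\<And>n. littlestone_dim C = enat n \<Longrightarrow> v \<le> real n" "v \<le> real d * log 2 (real T)"
  shows "v \<le> min_dim_bound C d T"
  using assms by (cases "littlestone_dim C") (auto simp: min_dim_bound_def min_def)

section \<open>The realizable game\<close>

definition real_payoff :: "real \<Rightarrow> bool list set \<Rightarrow> bool list \<Rightarrow> real" where
  "real_payoff M P ys = (if ys \<in> P then 0 else - M)"

text \<open>A revealed label leaves the same game for a subclass, so inductions can run over
  \<open>xs\<close> with \<open>C\<close> varying.\<close>

lemma real_payoff_Cons:
  "(\<lambda>ys. real_payoff M (patterns C (x # xs)) (y # ys)) =
     real_payoff M (patterns {c\<in>C. c x = y} xs)"
  by (auto simp: real_payoff_def fun_eq_iff image_iff)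

lemma real_value_nonneg:
  assumes "C \<noteq> {}"
  shows "0 \<le> game_value (length xs) (real_payoff M (patterns C xs))"
proof -
  obtain c where "c \<in> C" using assms by auto
  then have "map c xs \<in> patterns C xs" by blast
  then show ?thesis
    using game_value_ge[of "map c xs" "length xs" "real_payoff M (patterns C xs)"]
    by (auto simp: real_payoff_def)
qed

text \<open>
  The penalty \<open>M\<close> exceeds the number of rounds, so an unrealizable label never helps the
  adversary.
\<close>

lemma real_value_Cons:
  fixes C :: "('x \<Rightarrow> bool) set" and x :: 'x and M :: real
  defines "V \<equiv> \<lambda>xs C. game_value (length xs) (real_payoff M (patterns C xs))"
    and "CT \<equiv> {c\<in>C. c x}" and "CF \<equiv> {c\<in>C. \<not> c x}"
  assumes "C \<noteq> {}" "real (length (x # xs)) \<le> M"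
  shows "V (x # xs) C = (if CF = {} then V xs CT else if CT = {} then V xs CF
    else max (max (V xs CT) (V xs CF)) ((1 + V xs CT + V xs CF) / 2))"
proof -
  \<comment> \<open>An empty branch is worth at most -1. In the third term this cancels the 1 and
    leaves at most half of the other, nonnegative value.\<close>
  have empty: "V xs {} \<le> -1"
    using game_value_le[of "length xs" "real_payoff M {}" "- M"] assms(5)
    by (auto simp: V_def real_payoff_def)
  have V: "V (x # xs) C = max (max (V xs CT) (V xs CF)) ((1 + V xs CT + V xs CF) / 2)"
    unfolding V_def CT_def CF_def length_Cons game_value.simps real_payoff_Cons Let_def by simp
  have nn: "0 \<le> V xs D" if "D \<noteq> {}" for D
    using real_value_nonneg[OF that] by (simp add: V_def)
  have "CT \<noteq> {} \<or> CF \<noteq> {}" using assms by auto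
  then show ?thesis
    using empty nn[of CT] nn[of CF] unfolding V
    by (cases "CT = {}"; cases "CF = {}"; simp add: max_def)
qed

text \<open>Halving: for branches with \<open>NT\<close> and \<open>NF\<close> patterns,
  \<open>4 * NT * NF\<close> is at most the square of \<open>NT + NF\<close>. In logarithms this
  pays for the half mistake of a balanced round.\<close>

lemma real_value_le_log_card:
  assumes "C \<noteq> {}" "real (length xs) \<le> M"
  shows "game_value (length xs) (real_payoff M (patterns C xs)) \<le> log 2 (card (patterns C xs)) / 2"
  using assms
proof (induction xs arbitrary: C)
  case Nil
  then have "patterns C [] = {[]}" by auto
  then show ?case by (simp add: real_payoff_def)
next
  case (Cons x xs)
  define CT where "CT = {c\<in>C. c x}"
  define CF where "CF = {c\<in>C. \<not> c x}"
  define NT where "NT = real (card (patterns CT xs))"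
  define NF where "NF = real (card (patterns CF xs))"
  have N: "real (card (patterns C (x # xs))) = NT + NF"
    unfolding card_patterns_Cons NT_def NF_def CT_def CF_def by simp
  have pos: "1 \<le> real (card (patterns D xs))" if "D \<noteq> {}" for D
    using that card_gt_0_iff[of "patterns D xs"] finite_patterns[of xs D] by force
  have M: "real (length xs) \<le> M" using Cons.prems by simp
  note IH = Cons.IH[OF _ M]
  consider "CF = {}" "CT \<noteq> {}" | "CT = {}" "CF \<noteq> {}" | "CT \<noteq> {}" "CF \<noteq> {}"
    using Cons.prems by (auto simp: CT_def CF_def)
  then show ?case
  proof cases
    case 1
    then have "NF = 0" by (simp add: NF_def)
    then show ?thesis using 1 IH[of CT] N unfolding real_value_Cons[OF Cons.prems]
      by (auto simp flip: CT_def CF_def NT_def)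
  next
    case 2
    then have "NT = 0" by (simp add: NT_def)
    then show ?thesis using 2 IH[of CF] N unfolding real_value_Cons[OF Cons.prems]
      by (auto simp flip: CT_def CF_def NF_def)
  next
    case 3
    have NTF: "1 \<le> NT" "1 \<le> NF" using pos 3 by (auto simp: NT_def NF_def)
    have mono: "log 2 NT \<le> log 2 (NT + NF)" "log 2 NF \<le> log 2 (NT + NF)"
      using NTF by auto
    have "2 + log 2 NT + log 2 NF = log 2 (4 * (NT * NF))"
      using NTF log_pow_cancel[of 2 2] by (simp add: log_mult)
    also have "\<dots> \<le> log 2 ((NT + NF)\<^sup>2)"
      using NTF zero_le_power2[of "NT - NF"]
      by (subst log_le_cancel_iff) (auto simp: power2_eq_square algebra_simps add_pos_pos)
    also have "\<dots> = 2 * log 2 (NT + NF)"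
      using NTF by (simp add: log_nat_power)
    finally have "2 + log 2 NT + log 2 NF \<le> 2 * log 2 (NT + NF)" .
    then show ?thesis using 3 IH[of CT] IH[of CF] mono
      unfolding real_value_Cons[OF Cons.prems] N CT_def[symmetric] CF_def[symmetric]
        NT_def[symmetric] NF_def[symmetric]
      by (simp add: max_def)
  qed
qed

text \<open>If both halves shattered trees of height \<open>k\<close>, merging them would shatter
  one of height \<open>Suc k\<close>. So one half has value at most \<open>k - 1\<close>, the other
  at most \<open>k\<close>, and \<open>(1 + (k - 1) + k) / 2 = k\<close>.\<close>

lemma real_value_le_littlestone:
  assumes "C \<noteq> {}" "real (length xs) \<le> M"
    and "\<And>t. height t = Suc k \<Longrightarrow> \<not> littlestone_shatters C t"
  shows "game_value (length xs) (real_payoff M (patterns C xs)) \<le> real k"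
  using assms
proof (induction xs arbitrary: C k)
  case Nil
  then show ?case by (auto simp: real_payoff_def)
next
  case (Cons x xs)
  define CT where "CT = {c\<in>C. c x}"
  define CF where "CF = {c\<in>C. \<not> c x}"
  define V where "V = (\<lambda>C. game_value (length xs) (real_payoff M (patterns C xs)))"
  have M: "real (length xs) \<le> M" using Cons.prems by simp
  have sub: "CT \<subseteq> C" "CF \<subseteq> C" by (auto simp: CT_def CF_def)
  have IH: "V D \<le> real k" if "D \<noteq> {}" "D \<subseteq> C" for D
    unfolding V_def using that Cons.prems(3) littlestone_shatters_mono
    by (intro Cons.IH[OF _ M]) blast+
  have V: "game_value (length (x # xs)) (real_payoff M (patterns C (x # xs))) =
      (if CF = {} then V CT else if CT = {} then V CF
       else max (max (V CT) (V CF)) ((1 + V CT + V CF) / 2))"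
    using real_value_Cons[OF Cons.prems(1,2)] by (simp only: V_def CT_def CF_def)
  have ne: "CT \<noteq> {} \<or> CF \<noteq> {}" using Cons.prems by (auto simp: CT_def CF_def)
  show ?case
  proof (cases "CT = {} \<or> CF = {}")
    case True
    then show ?thesis using V IH sub ne by auto
  next
    case False
    have node: "False" if "littlestone_shatters CF l" "littlestone_shatters CT r"
      "height l = k" "height r = k" for l r
      using littlestone_shatters_Node[of C x l r] Cons.prems(3)[of "Node l x r"] that
      by (auto simp: CT_def CF_def)
    \<comment> \<open>Both halves are nonempty and hence shatter \<open>Leaf\<close>, which excludes
      \<open>k = 0\<close>.\<close>
    obtain j where k: "k = Suc j"
    proof (cases k)
      case 0
      have "littlestone_shatters D Leaf" if "D \<noteq> {}" for D :: "('a \<Rightarrow> bool) set"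
        using that by (auto simp: littlestone_shatters_def)
      then show ?thesis using node[of Leaf Leaf] False 0 by auto
    qed
    consider "\<And>t. height t = Suc j \<Longrightarrow> \<not> littlestone_shatters CT t" |
      "\<And>t. height t = Suc j \<Longrightarrow> \<not> littlestone_shatters CF t"
      using node k by blast
    then have "V CT \<le> real j \<or> V CF \<le> real j"
      using Cons.IH[OF _ M, of CT j] Cons.IH[OF _ M, of CF j] False unfolding V_def by auto
    then show ?thesis using False IH[of CT] IH[of CF] sub k unfolding V by auto
  qed
qed

lemma real_value_le_min_dim_bound:
  assumes "C \<noteq> {}" "vc_dim C = enat d" "real (length xs) \<le> M" "2 \<le> length xs"
  shows "game_value (length xs) (real_payoff M (patterns C xs)) \<le> min_dim_bound C d (length xs)"
proof (rule min_dim_bound_ge)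
  fix n assume n: "littlestone_dim C = enat n"
  show "game_value (length xs) (real_payoff M (patterns C xs)) \<le> real n"
  proof (rule real_value_le_littlestone[OF assms(1,3)], rule notI)
    fix t assume "height t = Suc n" "littlestone_shatters C t"
    then have "enat (Suc n) \<le> littlestone_dim C"
      unfolding littlestone_dim_def by (intro SUP_upper2[of t]) auto
    then show False using n by simp
  qed
next
  let ?T = "length xs" and ?N = "card (patterns C xs)"
  have "0 < ?N" using assms(1) finite_patterns[of xs C] by (auto simp: card_gt_0_iff)
  \<comment> \<open>Replacing \<open>T + 1\<close> by the square of \<open>T\<close> doubles the
    logarithm; the 1/2 in \<open>real_value_le_log_card\<close> cancels this.\<close>
  have "Suc ?T \<le> 2 * ?T" using assms(4) by simp
  also have "\<dots> \<le> ?T ^ 2"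
    unfolding power2_eq_square using assms(4) by (rule mult_right_mono) simp
  finally have "Suc ?T \<le> ?T ^ 2" .
  have "?N \<le> Suc ?T ^ d" by (rule card_patterns_le_vc_dim[OF assms(2)])
  also have "\<dots> \<le> (?T ^ 2) ^ d" using \<open>Suc ?T \<le> ?T ^ 2\<close> by (rule power_mono) simp
  also have "\<dots> = ?T ^ (2 * d)" by (simp add: power_mult)
  finally have "real ?N \<le> real ?T ^ (2 * d)" by (metis of_nat_le_iff of_nat_power)
  then have "log 2 ?N \<le> log 2 (real ?T ^ (2 * d))"
    using \<open>0 < ?N\<close> assms(4) by (subst log_le_cancel_iff) auto
  also have "\<dots> = 2 * (real d * log 2 ?T)"
    using assms(4) by (simp add: log_nat_power)
  finally show "game_value ?T (real_payoff M (patterns C xs)) \<le> real d * log 2 ?T"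
    using real_value_le_log_card[OF assms(1,3)] by linarith
qed

section \<open>The agnostic game\<close>

definition agn_payoff :: "bool list set \<Rightarrow> bool list \<Rightarrow> real" where
  "agn_payoff P ys = - (INF p\<in>P. \<Sum>t<length ys. of_bool (p ! t \<noteq> ys ! t))"

lemma agn_payoff_patterns:
  assumes "length ys = length xs"
  shows "agn_payoff (patterns C xs) ys =
    - (INF c\<in>C. \<Sum>t<length xs. of_bool (c (xs ! t) \<noteq> ys ! t))"
proof -
  have "(\<Sum>t<length ys. of_bool (map c xs ! t \<noteq> ys ! t) :: real) =
      (\<Sum>t<length xs. of_bool (c (xs ! t) \<noteq> ys ! t))" for c
    using assms by (intro sum.cong) auto
  then show ?thesis unfolding agn_payoff_def image_image by (simp only:)
qed

text \<open>Hoeffding's bound for a fair sign: with \<open>exp (- x)\<close> factored out, this is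
  \<open>Hoeffdings_lemma_aux\<close> at probability 1/2 and range \<open>2 * x\<close>.\<close>

lemma ln_cosh_le:
  fixes x :: real
  assumes "0 \<le> x"
  shows "ln (cosh x) \<le> x\<^sup>2 / 2"
proof -
  have "cosh x = exp (- x) * (1 + 1 / 2 * (exp (2 * x) - 1))"
    by (simp add: cosh_field_def algebra_simps flip: exp_add)
  moreover have "0 < 1 + 1 / 2 * (exp (2 * x) - 1)"
    by (simp add: field_simps add_pos_pos)
  ultimately have "ln (cosh x) = - (2 * x) * (1 / 2) + ln (1 + 1 / 2 * (exp (2 * x) - 1))"
    by (simp add: ln_mult_pos)
  also have "\<dots> \<le> (2 * x)\<^sup>2 / 8"
    using assms by (intro Hoeffdings_lemma_aux) auto
  finally show ?thesis by (simp add: power2_eq_square)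
qed

text \<open>
  The experts \<open>q i\<close> carry initial credits \<open>s i\<close> because, after a round, the suffixes of the
  experts play the same game with their losses so far as negative credit.
\<close>

lemma game_value_le_exp_potential:
  fixes q :: "'i \<Rightarrow> nat \<Rightarrow> bool"
  assumes "finite I" "I \<noteq> {}" "0 < \<eta>"
    and "\<And>ys. length ys = n \<Longrightarrow> \<exists>i\<in>I. \<phi> ys \<le> s i - (\<Sum>t<n. of_bool (q i t \<noteq> ys ! t))"
  shows "game_value n \<phi> \<le> ln (\<Sum>i\<in>I. exp (\<eta> * s i)) / \<eta> + real n * \<eta> / 8"
  using assms(4)
proof (induction n arbitrary: \<phi> s q)
  case 0
  then obtain i where i: "i \<in> I" "\<phi> [] \<le> s i" by auto
  have "exp (\<eta> * s i) \<le> (\<Sum>i\<in>I. exp (\<eta> * s i))"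
    using i assms(1) by (intro member_le_sum) auto
  then have "\<eta> * s i \<le> ln (\<Sum>i\<in>I. exp (\<eta> * s i))"
    by (metis exp_gt_zero less_le_trans ln_exp ln_le_cancel_iff)
  then have "s i \<le> ln (\<Sum>i\<in>I. exp (\<eta> * s i)) / \<eta>"
    using assms(3) by (simp add: field_simps)
  then show ?case using i by simp
next
  case (Suc n)
  define w where "w = (\<lambda>y. \<Sum>i\<in>I. exp (\<eta> * (s i - of_bool (q i 0 \<noteq> y))))"
  define W where "W = (\<Sum>i\<in>I. exp (\<eta> * s i))"
  define v where "v = (\<lambda>y. game_value n (\<lambda>ys. \<phi> (y # ys)))"
  have W: "0 < W" unfolding W_def using assms by (intro sum_pos) auto
  have w: "0 < w y" for y unfolding w_def using assms by (intro sum_pos) auto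
  have IH: "v y \<le> ln (w y) / \<eta> + real n * \<eta> / 8" for y
    unfolding v_def w_def
  proof (rule Suc.IH[where q = "\<lambda>i t. q i (Suc t)"])
    fix ys :: "bool list" assume "length ys = n"
    then show "\<exists>i\<in>I. \<phi> (y # ys) \<le> s i - of_bool (q i 0 \<noteq> y)
        - (\<Sum>t<n. of_bool (q i (Suc t) \<noteq> ys ! t))"
      using Suc.prems[of "y # ys"]
      by (auto simp: sum.lessThan_Suc_shift algebra_simps simp del: sum.lessThan_Suc)
  qed
  have "w y \<le> W" for y
    unfolding w_def W_def using assms(3) by (intro sum_mono) auto
  then have "ln (w y) / \<eta> \<le> ln W / \<eta>" for y
    using w W assms(3) by (intro divide_right_mono) auto
  then have le: "v y \<le> ln W / \<eta> + real (Suc n) * \<eta> / 8" for y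
    using IH[of y] assms(3) by (smt (verit) divide_right_mono mult_right_mono of_nat_Suc)
  \<comment> \<open>Each expert errs on exactly one of the two labels, so its weight enters once in
    full and once damped by \<open>exp (- \<eta>)\<close>.\<close>
  have "w True + w False = (1 + exp (- \<eta>)) * W"
    unfolding w_def W_def sum.distrib[symmetric] sum_distrib_left
    by (intro sum.cong) (auto simp: algebra_simps simp flip: exp_add)
  also have "1 + exp (- \<eta>) = 2 * exp (- \<eta> / 2) * cosh (\<eta> / 2)"
    by (simp add: cosh_field_def algebra_simps flip: exp_add)
  finally have sum: "w True + w False = 2 * (exp (- \<eta> / 2) * cosh (\<eta> / 2) * W)" by simp
  let ?z = "exp (- \<eta> / 2) * cosh (\<eta> / 2) * W"
  have "ln (w True) + ln (w False) = ln (w True * w False)"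
    using w by (simp add: ln_mult_pos)
  also have "\<dots> \<le> ln (?z\<^sup>2)"
  proof -
    have "4 * (w True * w False) \<le> (w True + w False)\<^sup>2"
      using zero_le_power2[of "w True - w False"] by (simp add: power2_eq_square algebra_simps)
    also have "\<dots> = 4 * ?z\<^sup>2" unfolding sum by (simp add: power2_eq_square)
    finally show ?thesis using w by (intro ln_mono) auto
  qed
  also have "\<dots> = 2 * (- \<eta> / 2 + ln (cosh (\<eta> / 2)) + ln W)"
    using W by (simp add: ln_realpow ln_mult_pos)
  also have "\<dots> \<le> 2 * (- \<eta> / 2 + (\<eta> / 2)\<^sup>2 / 2 + ln W)"
    using ln_cosh_le[of "\<eta> / 2"] assms(3) by simp
  finally have "(ln (w True) + ln (w False)) / \<eta> \<le> (2 * (- \<eta> / 2 + (\<eta> / 2)\<^sup>2 / 2 + ln W)) / \<eta>"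
    using assms(3) by (intro divide_right_mono) auto
  \<comment> \<open>The -1 cancels the mistake in the value formula, and half of
    \<open>\<eta> / 4\<close> is this round's share \<open>\<eta> / 8\<close>.\<close>
  also have "\<dots> = - 1 + \<eta> / 4 + 2 * (ln W / \<eta>)"
    using assms(3) by (simp add: field_simps power2_eq_square)
  finally have "(1 + v True + v False) / 2 \<le> ln W / \<eta> + real (Suc n) * \<eta> / 8"
    using IH[of True] IH[of False] by (simp add: add_divide_distrib algebra_simps)
  then show ?case using le[of True] le[of False] by (simp add: Let_def v_def W_def)
qed

lemma agn_value_le:
  assumes "C \<noteq> {}" "0 < \<eta>"
  shows "game_value (length xs) (agn_payoff (patterns C xs))
    \<le> ln (card (patterns C xs)) / \<eta> + real (length xs) * \<eta> / 8"
proof -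
  let ?P = "patterns C xs"
  have "\<exists>p\<in>?P. agn_payoff ?P ys \<le> 0 - (\<Sum>t<length xs. of_bool (p ! t \<noteq> ys ! t))"
    if "length ys = length xs" for ys
  proof -
    let ?h = "\<lambda>p. \<Sum>t<length xs. of_bool (p ! t \<noteq> ys ! t) :: real"
    have fin: "finite (?h ` ?P)" "?h ` ?P \<noteq> {}" using finite_patterns assms by auto
    \<comment> \<open>The infimum over a finite set is attained, so a single expert realizes the
      payoff.\<close>
    have "Inf (?h ` ?P) \<in> ?h ` ?P"
      unfolding cInf_eq_Min[OF fin] by (rule Min_in[OF fin])
    then obtain p where "p \<in> ?P" "Inf (?h ` ?P) = ?h p" by (rule imageE)
    then show ?thesis using that by (intro bexI[of _ p]) (simp_all only: agn_payoff_def diff_0 order_refl)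
  qed
  then show ?thesis
    using game_value_le_exp_potential[of ?P \<eta> "length xs" "agn_payoff ?P" "\<lambda>_. 0" "\<lambda>p t. p ! t"]
      assms finite_patterns[of xs C] by simp
qed

lemma agn_value_le_min_dim_bound:
  assumes "C \<noteq> {}" "vc_dim C = enat d" "2 \<le> length xs"
  shows "game_value (length xs) (agn_payoff (patterns C xs))
    \<le> 3 * log 2 (length xs) * sqrt (length xs * min_dim_bound C d (length xs))"
proof -
  define T where "T = real (length xs)"
  define V where "V = game_value (length xs) (agn_payoff (patterns C xs))"
  define N where "N = real (card (patterns C xs))"
  have T: "2 \<le> T" using assms by (simp add: T_def)
  have log1: "1 \<le> log 2 T" using T by simp
  have N: "1 \<le> N"
    using assms(1) finite_patterns[of xs C] card_gt_0_iff[of "patterns C xs"]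
    unfolding N_def by force
  have "N \<le> real (Suc (length xs) ^ d)"
    unfolding N_def using card_patterns_le_vc_dim[OF assms(2)] of_nat_le_iff by blast
  then have "N \<le> (T + 1) ^ d" by (simp add: T_def add.commute)
  then have "ln N \<le> ln ((T + 1) ^ d)" using N by (intro ln_mono) auto
  then have lnN: "ln N \<le> real d * ln (T + 1)" using T by (simp add: ln_realpow)
  have "T + 1 \<le> 2 * T" using T by simp
  also have "\<dots> \<le> T\<^sup>2"
    unfolding power2_eq_square using T by (intro mult_right_mono) auto
  finally have "ln (T + 1) \<le> ln (T\<^sup>2)" using T by (intro ln_mono) auto
  also have "\<dots> = 2 * (ln 2 * log 2 T)" using T by (simp add: ln_realpow log_def)
  also have "\<dots> \<le> 2 * (1 * log 2 T)"
    using log1 ln_2_less_1 by (intro mult_left_mono mult_right_mono) auto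
  finally have lnT: "ln (T + 1) \<le> 2 * log 2 T" by simp
  have bound: "V \<le> ln N / \<eta> + T * \<eta> / 8" if "0 < \<eta>" for \<eta>
    using agn_value_le[OF assms(1) that, of xs] by (simp add: V_def N_def T_def)
  have "V \<le> 3 * log 2 T * sqrt (T * real d)"
  proof (cases "d = 0")
    case True
    then have "ln N = 0" using lnN N by simp
    \<comment> \<open>The rate sqrt (d / T) would be 0 here. With \<open>8 * \<epsilon> / T\<close>
      the second term of \<open>bound\<close> is \<open>\<epsilon>\<close>, and the first is
      0.\<close>
    have "V \<le> \<epsilon>" if "0 < \<epsilon>" for \<epsilon>
      using bound[of "8 * \<epsilon> / T"] that T \<open>ln N = 0\<close> by simp
    then have "V \<le> 0" using field_le_epsilon[of V 0] by simp
    then show ?thesis using True by simp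
  next
    case False
    define r where "r = sqrt (T * real d)"
    have r: "0 < r" "r * r = T * real d" using T False by (auto simp: r_def)
    \<comment> \<open>\<open>r / T\<close> is sqrt (d / T); both terms become \<open>r\<close> up to
      a logarithm.\<close>
    have "V \<le> ln N / (r / T) + T * (r / T) / 8"
      using r T by (intro bound) auto
    also have "\<dots> = ln N * T / r + r / 8" using T by simp
    also have "ln N * T / r \<le> (real d * ln (T + 1)) * T / r"
      using lnN r T by (intro divide_right_mono mult_right_mono) auto
    also have "\<dots> = r * ln (T + 1)"
      using r by (simp add: field_simps)
    also have "\<dots> \<le> r * (2 * log 2 T)"
      using lnT r by (intro mult_left_mono) auto
    finally have "V \<le> r * (2 * log 2 T) + r * (1 / 8)" by simp
    \<comment> \<open>Absorbing this term into the logarithmic one gives the constant 2 + 1 =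
      3.\<close>
    also have "r * (1 / 8) \<le> r * log 2 T"
      using log1 r by (intro mult_left_mono) auto
    finally show ?thesis by (simp add: r_def algebra_simps)
  qed
  also have "real d \<le> min_dim_bound C d (length xs)"
  proof (rule min_dim_bound_ge)
    show "real d \<le> real n" if "littlestone_dim C = enat n" for n
      using vc_dim_le_littlestone_dim[of C] that assms(2) by simp
    show "real d \<le> real d * log 2 (real (length xs))"
      using mult_left_mono[OF log1, of "real d"] by (simp add: T_def)
  qed
  then have "3 * log 2 T * sqrt (T * real d)
      \<le> 3 * log 2 T * sqrt (T * min_dim_bound C d (length xs))"
    using T log1 by (intro mult_left_mono real_sqrt_le_mono) auto
  finally show ?thesis by (simp add: V_def T_def)
qed

section \<open>Optimality\<close>

text \<open>Hard-wires the oracle's answers. The optimal values allow learners that depend on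
  \<open>C\<close>, so a resolved learner is an admissible competitor.\<close>

primrec resolve :: "'x seq_oracle \<Rightarrow> 'x learner \<Rightarrow> 'x learner" where
  "resolve orc Halt = Halt"
| "resolve orc (Query S k) = resolve orc (k (orc S))"
| "resolve orc (Predict p k) = Predict p (\<lambda>yh y. resolve orc (k yh y))"

lemma query_free_resolve: "query_free (resolve orc L)"
  by (induction L) auto

lemma exp_mistakes_resolve: "exp_mistakes orc (resolve orc L) ys = exp_mistakes orc L ys"
proof (induction L arbitrary: ys)
  case (Predict p k)
  have "exp_mistakes orc (resolve orc (k a b)) ys = exp_mistakes orc (k a b) ys" for a b ys
    by (rule Predict.IH[OF rangeI rangeI])
  then show ?case by (simp split: list.split)
qed auto

lemma bdd_above_mistakes:
  "bdd_above ((\<lambda>(xs, c). exp_mistakes orc (L xs) (map c xs)) ` ({xs. length xs = T} \<times> C))"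
  by (rule bdd_aboveI[of _ "real T"]) (auto, metis exp_mistakes_bounds length_map)

lemma exp_regret_bounds:
  assumes "C \<noteq> {}" "length xs = T" "length ys = T"
  shows "- real T \<le> exp_regret C L xs ys" "exp_regret C L xs ys \<le> real T"
proof -
  let ?h = "\<lambda>c. \<Sum>t<length xs. of_bool (c (xs ! t) \<noteq> ys ! t) :: real"
  obtain c where c: "c \<in> C" using assms by auto
  have "0 \<le> (INF c\<in>C. ?h c)" using assms by (intro cINF_greatest) (auto intro!: sum_nonneg)
  moreover have "(INF c\<in>C. ?h c) \<le> ?h c"
    using c by (intro cINF_lower bdd_belowI[of _ 0]) (auto intro!: sum_nonneg)
  moreover have "?h c \<le> (\<Sum>t<length xs. 1)" by (intro sum_mono) auto
  ultimately show "- real T \<le> exp_regret C L xs ys" "exp_regret C L xs ys \<le> real T"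
    using exp_mistakes_bounds[of "weak_consistency C" "L xs" ys] assms
    unfolding exp_regret_def by auto
qed

lemma bdd_above_regret:
  assumes "C \<noteq> {}"
  shows "bdd_above ((\<lambda>(xs, ys). exp_regret C L xs ys) ` ({xs. length xs = T} \<times> {ys. length ys = T}))"
  by (rule bdd_aboveI[of _ "real T"]) (use exp_regret_bounds(2)[OF assms] in auto)

text \<open>On each sequence every competitor does as badly as \<open>A\<close> for some concept,
  which compares the suprema. Conversely, \<open>resolve\<close> makes \<open>A\<close> a
  competitor.\<close>

lemma worst_mistakes_eq_opt:
  assumes "C \<noteq> {}"
    and opt: "\<And>xs c L. length xs = T \<Longrightarrow> c \<in> C \<Longrightarrow> \<exists>c'\<in>C.
      exp_mistakes (weak_consistency C) (A xs) (map c xs)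
      \<le> exp_mistakes (weak_consistency C) L (map c' xs)"
  shows "worst_mistakes C T A = opt_mistakes C T"
proof (rule antisym)
  have ne: "{xs :: 'a list. length xs = T} \<times> C \<noteq> {}"
    using assms(1) length_replicate[of T undefined] by fast
  have "worst_mistakes C T A \<le> worst_mistakes C T L" for L
    unfolding worst_mistakes_def
  proof (rule cSUP_mono[OF ne bdd_above_mistakes])
    fix z assume "z \<in> {xs :: 'a list. length xs = T} \<times> C"
    then obtain xs c where z: "z = (xs, c)" "length xs = T" "c \<in> C" by auto
    then obtain c' where "c' \<in> C" "exp_mistakes (weak_consistency C) (A xs) (map c xs)
      \<le> exp_mistakes (weak_consistency C) (L xs) (map c' xs)"
      using opt by blast
    then show "\<exists>z'\<in>{xs. length xs = T} \<times> C.
      (case z of (xs, c) \<Rightarrow> exp_mistakes (weak_consistency C) (A xs) (map c xs))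
      \<le> (case z' of (xs, c) \<Rightarrow> exp_mistakes (weak_consistency C) (L xs) (map c xs))"
      using z by (intro bexI[of _ "(xs, c')"]) auto
  qed
  moreover have "{L :: 'a list \<Rightarrow> 'a learner. \<forall>xs. query_free (L xs)} \<noteq> {}"
    by (auto intro!: exI[of _ "\<lambda>_. Halt"])
  ultimately show "worst_mistakes C T A \<le> opt_mistakes C T"
    unfolding opt_mistakes_def by (intro cINF_greatest) auto
  define A' where "A' = (\<lambda>xs. resolve (weak_consistency C) (A xs))"
  have "0 \<le> worst_mistakes C T L" for L
  proof -
    obtain z where "z \<in> {xs :: 'a list. length xs = T} \<times> C" using ne by blast
    then show ?thesis unfolding worst_mistakes_def
      by (intro cSUP_upper2[OF bdd_above_mistakes, of z]) (auto simp: exp_mistakes_bounds)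
  qed
  then have "opt_mistakes C T \<le> worst_mistakes C T A'"
    unfolding opt_mistakes_def
    by (intro cINF_lower bdd_belowI[of _ 0]) (auto simp: A'_def query_free_resolve)
  also have "\<dots> = worst_mistakes C T A"
    by (simp add: worst_mistakes_def A'_def exp_mistakes_resolve)
  finally show "opt_mistakes C T \<le> worst_mistakes C T A" .
qed

lemma worst_regret_eq_opt:
  assumes "C \<noteq> {}"
    and opt: "\<And>xs ys L. length xs = T \<Longrightarrow> length ys = T \<Longrightarrow>
      \<exists>ys'. length ys' = T \<and> exp_regret C A xs ys \<le> exp_regret C L xs ys'"
  shows "worst_regret C T A = opt_regret C T"
proof (rule antisym)
  let ?S = "{xs :: 'a list. length xs = T} \<times> {ys :: bool list. length ys = T}"
  have ne: "?S \<noteq> {}"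
    using length_replicate[of T "undefined :: 'a"] length_replicate[of T True] by fast
  have "worst_regret C T A \<le> worst_regret C T L" for L
    unfolding worst_regret_def
  proof (rule cSUP_mono[OF ne bdd_above_regret[OF assms(1)]])
    fix z assume "z \<in> ?S"
    then obtain xs ys where z: "z = (xs, ys)" "length xs = T" "length ys = T" by auto
    then obtain ys' where "length ys' = T" "exp_regret C A xs ys \<le> exp_regret C L xs ys'"
      using opt by blast
    then show "\<exists>z'\<in>?S. (case z of (xs, ys) \<Rightarrow> exp_regret C A xs ys)
      \<le> (case z' of (xs, ys) \<Rightarrow> exp_regret C L xs ys)"
      using z by (intro bexI[of _ "(xs, ys')"]) auto
  qed
  moreover have "{L :: 'a list \<Rightarrow> 'a learner. \<forall>xs. query_free (L xs)} \<noteq> {}"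
    by (auto intro!: exI[of _ "\<lambda>_. Halt"])
  ultimately show "worst_regret C T A \<le> opt_regret C T"
    unfolding opt_regret_def by (intro cINF_greatest) auto
  define A' where "A' = (\<lambda>xs. resolve (weak_consistency C) (A xs))"
  \<comment> \<open>Regret may be negative, so the infimum is bounded below by
    \<open>- real T\<close> instead of 0.\<close>
  have "- real T \<le> worst_regret C T L" for L
  proof -
    obtain z where "z \<in> ?S" using ne by blast
    then show ?thesis unfolding worst_regret_def
      by (intro cSUP_upper2[OF bdd_above_regret[OF assms(1)], of z])
        (auto simp: exp_regret_bounds[OF assms(1)])
  qed
  then have "opt_regret C T \<le> worst_regret C T A'"
    unfolding opt_regret_def
    by (intro cINF_lower bdd_belowI[of _ "- real T"]) (auto simp: A'_def query_free_resolve)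
  also have "\<dots> = worst_regret C T A"
    by (simp add: worst_regret_def exp_regret_def A'_def exp_mistakes_resolve)
  finally show "opt_regret C T \<le> worst_regret C T A" .
qed

section \<open>The learner and its guarantees\<close>

fun payoff :: "setting \<Rightarrow> nat \<Rightarrow> bool list set \<Rightarrow> bool list \<Rightarrow> real" where
  "payoff Realizable n P = real_payoff (real n + 1) P"
| "payoff Agnostic n P = agn_payoff P"

definition projection_learner :: "setting \<Rightarrow> 'x list \<Rightarrow> 'x learner" where
  "projection_learner s xs = with_projection xs
     (\<lambda>R. play (length xs) (payoff s (length xs) (map snd ` set R)))"

lemma num_queries_projection_learner:
  assumes "C \<noteq> {}" "vc_dim C = enat d"
  shows "num_queries (weak_consistency C) (projection_learner s xs) ys \<le> 2 * length xs ^ (d + 1)"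
proof -
  let ?R = "\<lambda>i. projection (weak_consistency C) (drop (Suc i) xs)"
  have "num_queries (weak_consistency C) (projection_learner s xs) ys =
      (\<Sum>i<length xs. 2 * length (?R i))"
    by (simp add: projection_learner_def num_queries_with_projection)
  also have "\<dots> \<le> (\<Sum>i<length xs. 2 * length xs ^ d)"
  proof (intro sum_mono mult_left_mono)
    fix i assume i: "i \<in> {..<length xs}"
    have "length (?R i) \<le> Suc (length (drop (Suc i) xs)) ^ d"
      unfolding length_projection[OF assms(1)] by (rule card_patterns_le_vc_dim[OF assms(2)])
    \<comment> \<open>The suffix after point \<open>i\<close> has fewer than
      \<open>length xs\<close> points, which absorbs the \<open>Suc\<close>.\<close>
    also have "\<dots> \<le> length xs ^ d" using i by (intro power_mono) auto
    finally show "length (?R i) \<le> length xs ^ d" .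
  qed simp
  finally show ?thesis by simp
qed

lemma exp_mistakes_projection_learner:
  assumes "C \<noteq> {}" "length ys = length xs"
  shows "exp_mistakes (weak_consistency C) (projection_learner s xs) ys
      + payoff s (length xs) (patterns C xs) ys
    \<le> game_value (length xs) (payoff s (length xs) (patterns C xs))"
  using play_upper[OF assms(2)]
  by (simp add: projection_learner_def exp_mistakes_with_projection patterns_projection[OF assms(1)])

lemma mistakes_projection_learner:
  assumes "c \<in> C"
  shows "exp_mistakes (weak_consistency C) (projection_learner Realizable xs) (map c xs)
    \<le> game_value (length xs) (real_payoff (real (length xs) + 1) (patterns C xs))"
proof -
  have "C \<noteq> {}" "map c xs \<in> patterns C xs" using assms by auto
  then show ?thesis
    using exp_mistakes_projection_learner[of C "map c xs" xs Realizable]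
    by (simp add: real_payoff_def)
qed

lemma regret_projection_learner:
  assumes "C \<noteq> {}" "length ys = length xs"
  shows "exp_regret C (projection_learner Agnostic) xs ys
    \<le> game_value (length xs) (agn_payoff (patterns C xs))"
  using exp_mistakes_projection_learner[OF assms, of Agnostic]
  by (simp add: exp_regret_def agn_payoff_patterns[OF assms(2)])

text \<open>Off the patterns, at most \<open>length xs\<close> mistakes minus the penalty
  \<open>length xs + 1\<close> is negative, while the value is not. The hard sequence is therefore
  realizable.\<close>

lemma mistakes_lower:
  assumes "C \<noteq> {}"
  shows "\<exists>c\<in>C. game_value (length xs) (real_payoff (real (length xs) + 1) (patterns C xs))
    \<le> exp_mistakes orc L (map c xs)"
proof -
  let ?M = "real (length xs) + 1"
  let ?V = "game_value (length xs) (real_payoff ?M (patterns C xs))"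
  obtain ys where ys: "length ys = length xs"
    "?V \<le> exp_mistakes orc L ys + real_payoff ?M (patterns C xs) ys"
    using game_value_lower by blast
  have "0 \<le> ?V" by (rule real_value_nonneg[OF assms])
  then have "ys \<in> patterns C xs"
    using ys exp_mistakes_bounds[of orc L ys] by (auto simp: real_payoff_def split: if_splits)
  then show ?thesis using ys by (auto simp: real_payoff_def)
qed

lemma regret_lower:
  "\<exists>ys. length ys = length xs \<and>
     game_value (length xs) (agn_payoff (patterns C xs)) \<le> exp_regret C L xs ys"
  using game_value_lower[of "length xs" "agn_payoff (patterns C xs)" "weak_consistency C" "L xs"]
  by (auto simp: exp_regret_def agn_payoff_patterns)

theorem theorem4p2:
  "\<exists>(K::real) (p::nat). \<forall>(d::nat) (F :: ('x \<Rightarrow> bool) set set).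
     (\<forall>C\<in>F. C \<noteq> {} \<and> vc_dim C = enat d) \<longrightarrow>
     (\<exists>A :: setting \<Rightarrow> 'x list \<Rightarrow> 'x learner. \<forall>C\<in>F. \<forall>T.
        (\<forall>s xs ys. length xs = T \<and> length ys = T \<longrightarrow>
           real (num_queries (weak_consistency C) (A s xs) ys) \<le> K * real T ^ (d + 1)) \<and>
        worst_mistakes C T (A Realizable) = opt_mistakes C T \<and>
        worst_regret C T (A Agnostic) = opt_regret C T \<and>
        (T \<ge> 2 \<longrightarrow>
           worst_mistakes C T (A Realizable) \<le> min_dim_bound C d T \<and>
           worst_regret C T (A Agnostic) \<le>
             K * log 2 (real T) ^ p * sqrt (real T * min_dim_bound C d T)))"
\<comment> \<open>The constant 3 and the single logarithm come from the regret bound. One learner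
  serves all families, since it reaches the class only through its queries.\<close>
proof (rule exI[of _ 3], rule exI[of _ 1],
    intro allI impI exI[of _ projection_learner] ballI conjI)
  fix d T :: nat and F :: "('x \<Rightarrow> bool) set set" and C
  assume F: "\<forall>C\<in>F. C \<noteq> {} \<and> vc_dim C = enat d" and "C \<in> F"
  then have C: "C \<noteq> {}" "vc_dim C = enat d" by auto
  let ?A = "projection_learner :: setting \<Rightarrow> 'x list \<Rightarrow> 'x learner"
  show "real (num_queries (weak_consistency C) (?A s xs) ys) \<le> 3 * real T ^ (d + 1)"
    if "length xs = T \<and> length ys = T" for s xs ys
  proof -
    have "real (num_queries (weak_consistency C) (?A s xs) ys) \<le> real (2 * T ^ (d + 1))"
      using num_queries_projection_learner[OF C, of s xs ys] that of_nat_le_iff by metis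
    also have "\<dots> \<le> 3 * real T ^ (d + 1)" by simp
    finally show ?thesis .
  qed
  show "worst_mistakes C T (?A Realizable) = opt_mistakes C T"
  proof (rule worst_mistakes_eq_opt[OF C(1)])
    fix xs :: "'x list" and c L assume "length xs = T" "c \<in> C"
    then show "\<exists>c'\<in>C. exp_mistakes (weak_consistency C) (?A Realizable xs) (map c xs)
        \<le> exp_mistakes (weak_consistency C) L (map c' xs)"
      using mistakes_lower[OF C(1), of xs "weak_consistency C" L]
        mistakes_projection_learner[of c C xs]
      by (blast intro: order_trans)
  qed
  show "worst_regret C T (?A Agnostic) = opt_regret C T"
  proof (rule worst_regret_eq_opt[OF C(1)])
    fix xs :: "'x list" and ys :: "bool list" and L
    assume "length xs = T" "length ys = T"
    then show "\<exists>ys'. length ys' = T \<and> exp_regret C (?A Agnostic) xs ys \<le> exp_regret C L xs ys'"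
      using regret_projection_learner[OF C(1), of ys xs] regret_lower[of xs C L]
      by (metis order_trans)
  qed
  assume T: "2 \<le> T"
  show "worst_mistakes C T (?A Realizable) \<le> min_dim_bound C d T"
    unfolding worst_mistakes_def
  proof (rule cSUP_least)
    fix z assume "z \<in> {xs :: 'x list. length xs = T} \<times> C"
    then obtain xs c where z: "z = (xs, c)" "length xs = T" "c \<in> C" by auto
    then show "(case z of (xs, c) \<Rightarrow>
        exp_mistakes (weak_consistency C) (?A Realizable xs) (map c xs)) \<le> min_dim_bound C d T"
      using order_trans[OF mistakes_projection_learner real_value_le_min_dim_bound[OF C]] T
      by force
  qed (use Ex_list_of_length[of T] C(1) in auto)
  show "worst_regret C T (?A Agnostic) \<le>
      3 * log 2 (real T) ^ 1 * sqrt (real T * min_dim_bound C d T)"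
    unfolding worst_regret_def
  proof (rule cSUP_least)
    fix z assume "z \<in> {xs :: 'x list. length xs = T} \<times> {ys :: bool list. length ys = T}"
    then obtain xs ys where z: "z = (xs, ys)" "length xs = T" "length ys = T" by auto
    then show "(case z of (xs, ys) \<Rightarrow> exp_regret C (?A Agnostic) xs ys)
        \<le> 3 * log 2 (real T) ^ 1 * sqrt (real T * min_dim_bound C d T)"
      using order_trans[OF regret_projection_learner[OF C(1)] agn_value_le_min_dim_bound[OF C]] T
      by force
  qed (auto simp: Ex_list_of_length)
qed

end
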